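(* Let $f(t)=\sum_{k=0}^n a_kt^k$ with $n\ge1$ and $a_n\ne0$, and put $c_m=\sum_{k=m+1}^n k\binom{k-1}{m}a_k$ for $0\le m\le n-1$. (Complex case.) Suppose $a_k\in\mathbb{C}$ and $(-1)^n\mathrm{Re}(a_n)<0$. Let $\phi_f(x)=\exp(f(x))$ for $x\le0$ and $\Phi_f(s)=\int_{-\infty}^0(1-x)^s\phi_f(x)\,dx$ for $s\in\mathbb{C}$ (with $(1-x)^s=\exp(s\log(1-x))$, real log). Then the integral converges for every $s\in\mathbb{C}$, $\phi_f'(x)=\sum_{m=0}^{n-1}(-1)^mc_m(1-x)^m\phi_f(x)$, and for all $s\in\mathbb{C}$ $$\exp(a_0)+s\Phi_f(s-1)=\sum_{m=0}^{n-1}(-1)^mc_m\,\Phi_f(s+m).$$ ($p$-adic case.) Suppose $a_k\in\mathcal{O}_{\mathbb{C}_p}$, $a_0\in E_p$ and $a_1\in U_1$. Let $\phi_f\in C(\mathbb{Z}_p,\mathbb{C}_p)$ be the unique function with $A(\phi_f)=\exp(a_0)\exp(f(t)-a_0)$, and let $\Phi_f=T(\phi_f)$, i.e. $\Phi_f(s)=S^s(\phi_f)(-1)$ for $s\in\mathbb{Z}_p$. Then $\sigma(\phi_f)=\sum_{m=0}^{n-1}(-1)^mc_m\,S^m(\phi_f)$, and for all $s\in\mathbb{Z}_p$ $$\exp(a_0)+s\Phi_f(s-1)=\sum_{m=0}^{n-1}(-1)^mc_m\,\Phi_f(s+m).$$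
   Context: Fix a prime $p$; $\mathbb{C}_p$ is the completion of an algebraic closure of $\mathbb{Q}_p$ with $|p|=1/p$; $\mathcal{O}_{\mathbb{C}_p}=\{|x|\le1\}$, $U_1=\{|x-1|<1\}$, $E_p=\{|x|<p^{-1/(p-1)}\}$ (where the exponential series converges). $C(\mathbb{Z}_p,\mathbb{C}_p)$ is the space of continuous functions $\mathbb{Z}_p\to\mathbb{C}_p$; $\sigma(\phi)(x)=\phi(x+1)$; $A(\phi)=\sum_{n\ge0}\phi(n)t^n/n!$ (injective); the existence and uniqueness of $\phi_f$ holds for any $f\in\mathcal{O}_{\mathbb{C}_p}[[t]]$ with $f(0)\in E_p$, $f'(0)\in U_1$. For $n\ge0$, $\binom xn=x(x-1)\cdots(x-n+1)/n!$, and for $y\in\mathbb{Z}_p$, $S^y(\phi)(x)=\sum_{k\ge0}(-1)^kk!\binom yk\binom xk\phi(x-k)$. In both cases $\exp$ denotes the exponential series. *)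

theory Defs
  imports "HOL-Analysis.Analysis" "HOL-Computational_Algebra.Formal_Power_Series"
          "HOL-Computational_Algebra.Polynomial"
begin

definition fpoly :: "(nat \<Rightarrow> 'b::comm_ring_1) \<Rightarrow> nat \<Rightarrow> 'b \<Rightarrow> 'b" where
  "fpoly a n x = (\<Sum>k\<le>n. a k * x ^ k)"

definition ccoef :: "(nat \<Rightarrow> 'b::comm_ring_1) \<Rightarrow> nat \<Rightarrow> nat \<Rightarrow> 'b" where
  "ccoef a n m = (\<Sum>k\<in>{m+1..n}. of_nat (k * ((k - 1) choose m)) * a k)"

definition phiC :: "(nat \<Rightarrow> complex) \<Rightarrow> nat \<Rightarrow> real \<Rightarrow> complex" where
  "phiC a n x = exp (fpoly a n (complex_of_real x))"

definition cpowC :: "real \<Rightarrow> complex \<Rightarrow> complex" where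
  "cpowC x s = exp (s * complex_of_real (ln (1 - x)))"

definition PhiC_integrand :: "(nat \<Rightarrow> complex) \<Rightarrow> nat \<Rightarrow> complex \<Rightarrow> real \<Rightarrow> complex" where
  "PhiC_integrand a n s x = cpowC x s * phiC a n x"

definition PhiC :: "(nat \<Rightarrow> complex) \<Rightarrow> nat \<Rightarrow> complex \<Rightarrow> complex" where
  "PhiC a n s = (LINT x:{..0::real}|lborel. PhiC_integrand a n s x)"

text \<open>C_p is modelled as a field of characteristic 0 carrying an absolute value absv
  which is nonarchimedean with |p| = 1/p, complete, algebraically closed, and in which
  the algebraic numbers are dense.  These properties characterise C_p up to
  isometric isomorphism.\<close>

definition is_nonarch_abs :: "nat \<Rightarrow> ('a::field_char_0 \<Rightarrow> real) \<Rightarrow> bool" where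
  "is_nonarch_abs p absv \<longleftrightarrow>
     (\<forall>x. absv x \<ge> 0) \<and> (\<forall>x. absv x = 0 \<longleftrightarrow> x = 0) \<and>
     (\<forall>x y. absv (x * y) = absv x * absv y) \<and>
     (\<forall>x y. absv (x + y) \<le> max (absv x) (absv y)) \<and>
     absv (of_nat p) = 1 / real p"

definition pconv :: "('a::field_char_0 \<Rightarrow> real) \<Rightarrow> (nat \<Rightarrow> 'a) \<Rightarrow> 'a \<Rightarrow> bool" where
  "pconv absv X L \<longleftrightarrow> (\<forall>e>0. \<exists>N. \<forall>k\<ge>N. absv (X k - L) < e)"

definition pcauchy :: "('a::field_char_0 \<Rightarrow> real) \<Rightarrow> (nat \<Rightarrow> 'a) \<Rightarrow> bool" where
  "pcauchy absv X \<longleftrightarrow> (\<forall>e>0. \<exists>N. \<forall>k\<ge>N. \<forall>l\<ge>N. absv (X k - X l) < e)"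

definition is_Cp :: "nat \<Rightarrow> ('a::field_char_0 \<Rightarrow> real) \<Rightarrow> bool" where
  "is_Cp p absv \<longleftrightarrow> prime p \<and> is_nonarch_abs p absv \<and>
     (\<forall>X. pcauchy absv X \<longrightarrow> (\<exists>L. pconv absv X L)) \<and>
     (\<forall>q::'a poly. degree q \<ge> 1 \<longrightarrow> (\<exists>x. poly q x = 0)) \<and>
     (\<forall>x. \<forall>e>0. \<exists>y. algebraic y \<and> absv (x - y) < e)"

definition Zp :: "('a::field_char_0 \<Rightarrow> real) \<Rightarrow> 'a set" where
  "Zp absv = {x. \<exists>X::nat \<Rightarrow> int. pconv absv (\<lambda>k. of_int (X k)) x}"

definition OCp :: "('a::field_char_0 \<Rightarrow> real) \<Rightarrow> 'a set" where
  "OCp absv = {x. absv x \<le> 1}"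

definition U1 :: "('a::field_char_0 \<Rightarrow> real) \<Rightarrow> 'a set" where
  "U1 absv = {x. absv (x - 1) < 1}"

definition Ep :: "nat \<Rightarrow> ('a::field_char_0 \<Rightarrow> real) \<Rightarrow> 'a set" where
  "Ep p absv = {x. absv x < real p powr (- 1 / (real p - 1))}"

definition psum :: "('a::field_char_0 \<Rightarrow> real) \<Rightarrow> (nat \<Rightarrow> 'a) \<Rightarrow> 'a" where
  "psum absv g = (THE L. pconv absv (\<lambda>N. \<Sum>k<N. g k) L)"

definition pexp :: "('a::field_char_0 \<Rightarrow> real) \<Rightarrow> 'a \<Rightarrow> 'a" where
  "pexp absv x = psum absv (\<lambda>k. x ^ k / fact k)"

definition pcont_on :: "('a::field_char_0 \<Rightarrow> real) \<Rightarrow> 'a set \<Rightarrow> ('a \<Rightarrow> 'a) \<Rightarrow> bool" where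
  "pcont_on absv S \<phi> \<longleftrightarrow> (\<forall>x\<in>S. \<forall>e>0. \<exists>d>0. \<forall>y\<in>S.
      absv (y - x) < d \<longrightarrow> absv (\<phi> y - \<phi> x) < e)"

definition Aop :: "('a::field_char_0 \<Rightarrow> 'a) \<Rightarrow> 'a fps" where
  "Aop \<phi> = Abs_fps (\<lambda>k. \<phi> (of_nat k) / fact k)"

definition f_fps :: "(nat \<Rightarrow> 'a::field_char_0) \<Rightarrow> nat \<Rightarrow> 'a fps" where
  "f_fps a n = Abs_fps (\<lambda>k. if k \<le> n then a k else 0)"

definition Sop :: "('a::field_char_0 \<Rightarrow> real) \<Rightarrow> 'a \<Rightarrow> ('a \<Rightarrow> 'a) \<Rightarrow> 'a \<Rightarrow> 'a" where
  "Sop absv y \<phi> x = psum absv (\<lambda>k. (-1) ^ k * fact k * (y gchoose k) * (x gchoose k)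
        * \<phi> (x - of_nat k))"

definition PhiP :: "('a::field_char_0 \<Rightarrow> real) \<Rightarrow> ('a \<Rightarrow> 'a) \<Rightarrow> 'a \<Rightarrow> 'a" where
  "PhiP absv \<phi> s = Sop absv s \<phi> (-1)"

end

theory Submission
  imports Defs "HOL-Real_Asymp.Real_Asymp"
begin

text \<open>
  In the complex case the equation is integration by parts for \<open>(1 - x)\<^sup>s \<phi>\<^sub>f(x)\<close>,
  with \<open>f'\<close> expanded in powers of \<open>1 - x\<close>.

  In the \<open>p\<close>-adic case put \<open>S \<psi>(x) = \<psi>(x) - x \<psi>(x - 1)\<close>, so that \<open>S\<^sup>m\<close> is the \<open>m\<close>-fold
  iterate of \<open>S\<close> and \<open>S\<^bsup>y+m\<^esup> = S\<^sup>y \<circ> S\<^sup>m\<close>.  The differential equation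
  \<open>A(\<phi>\<^sub>f)' = f' A(\<phi>\<^sub>f)\<close>, read off coefficientwise and re-expanded in powers of \<open>S\<close>, is
  \<open>\<sigma>(\<phi>\<^sub>f) = \<Sum> (-1)\<^sup>m c\<^sub>m S\<^sup>m(\<phi>\<^sub>f)\<close> on \<open>\<nat>\<close>, hence on \<open>\<int>\<^sub>p\<close> by density.  Applying \<open>S\<^sup>s\<close> at
  \<open>-1\<close> turns the right-hand side into the claimed sum, while on the left
  \<open>S\<^sup>s(\<sigma>\<psi>)(-1) = \<psi>(0) + s S\<^bsup>s-1\<^esup>(\<psi>)(-1)\<close>.
\<close>

text \<open>Insert the definition of \<open>ccoef\<close>, put \<open>k = Suc j\<close> and exchange
  the two sums. Both cases rest on this: with \<open>g m = (x - 1) ^ m\<close>, or with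
  \<open>g m\<close> a signed iterate of \<open>Sstep\<close>, the inner binomial sum collapses to a
  closed form.\<close>

lemma sum_ccoef_mult:
  fixes a :: "nat \<Rightarrow> 'a::comm_ring_1"
  shows "(\<Sum>m<n. ccoef a n m * g m) =
         (\<Sum>j<n. of_nat (Suc j) * a (Suc j) * (\<Sum>m\<le>j. of_nat (j choose m) * g m))"
proof -
  have c: "ccoef a n m = (\<Sum>j<n. of_nat (Suc j * (j choose m)) * a (Suc j))" for m
  proof -
    have "(\<Sum>j<n. of_nat (Suc j * (j choose m)) * a (Suc j)) =
          (\<Sum>k\<in>{1..n}. of_nat (k * ((k - 1) choose m)) * a k)"
      by (rule sum.reindex_bij_witness[where i = "\<lambda>k. k - 1" and j = Suc]) auto
    \<comment> \<open>The terms with \<open>1 \<le> k \<le> m\<close> vanish because then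
      \<open>k - 1 < m\<close>. The summation range thus becomes independent of \<open>m\<close>, as
      the exchange of sums requires.\<close>
    also have "\<dots> = ccoef a n m"
      unfolding ccoef_def
      by (rule sum.mono_neutral_right) (auto simp: binomial_eq_0 not_le)
    finally show ?thesis by simp
  qed
  have d: "(\<Sum>m<n. of_nat (j choose m) * g m) = (\<Sum>m\<le>j. of_nat (j choose m) * g m)"
    if "j < n" for j
    using that by (intro sum.mono_neutral_right) (auto simp: binomial_eq_0 not_le)
  have "(\<Sum>m<n. ccoef a n m * g m) =
        (\<Sum>m<n. \<Sum>j<n. of_nat (Suc j) * a (Suc j) * (of_nat (j choose m) * g m))"
    unfolding c sum_distrib_right of_nat_mult by (simp only: ac_simps)
  also have "\<dots> = (\<Sum>j<n. \<Sum>m<n. of_nat (Suc j) * a (Suc j) * (of_nat (j choose m) * g m))"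
    by (rule sum.swap)
  also have "\<dots> = (\<Sum>j<n. of_nat (Suc j) * a (Suc j) * (\<Sum>m\<le>j. of_nat (j choose m) * g m))"
    by (simp add: d flip: sum_distrib_left)
  finally show ?thesis .
qed

subsection \<open>The complex case\<close>

text \<open>With \<open>x = - t\<close> the modulus is \<open>exp (E t)\<close>, where the leading
  term (-1)^n Re(a_n) t^n of \<open>E\<close> is negative and dominates both the lower powers and
  the logarithm coming from \<open>cpowC\<close>.\<close>

lemma PhiC_integrand_tendsto_0:
  assumes n: "n \<ge> 1" and neg: "(-1) ^ n * Re (a n) < 0"
  shows "(PhiC_integrand a n s \<longlongrightarrow> 0) at_bot"
proof -
  define b where "b k = (-1) ^ k * Re (a k)" for k
  define E where "E t = Re s * ln (1 + t) + (\<Sum>k\<le>n. b k * t ^ k)" for t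
  have norm: "norm (PhiC_integrand a n s (- t)) = exp (E t)" for t
  proof -
    have "Re (fpoly a n (complex_of_real (- t))) = (\<Sum>k\<le>n. b k * t ^ k)"
      unfolding fpoly_def Re_sum b_def
      by (intro sum.cong refl) (simp add: power_minus[of t] flip: of_real_power of_real_minus)
    then show ?thesis
      by (simp add: PhiC_integrand_def cpowC_def phiC_def norm_mult E_def exp_add)
  qed
  \<comment> \<open>The exponent \<open>n\<close> is symbolic, so the quotient is compared with that
    for exponent 1 on \<open>t \<ge> 1\<close>.\<close>
  have ln: "((\<lambda>t::real. ln (1 + t) / t ^ n) \<longlongrightarrow> 0) at_top"
  proof (rule tendsto_sandwich[where f = "\<lambda>_. 0" and h = "\<lambda>t. ln (1 + t) / t"])
    show "((\<lambda>t::real. ln (1 + t) / t) \<longlongrightarrow> 0) at_top"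
      by real_asymp
    show "\<forall>\<^sub>F t::real in at_top. ln (1 + t) / t ^ n \<le> ln (1 + t) / t"
      using eventually_ge_at_top[of 1]
    proof eventually_elim
      case (elim t)
      then have "t ^ 1 \<le> t ^ n" using n by (intro power_increasing) auto
      then show ?case using elim by (intro divide_left_mono) auto
    qed
    show "\<forall>\<^sub>F t::real in at_top. 0 \<le> ln (1 + t) / t ^ n"
      using eventually_ge_at_top[of 1] by eventually_elim auto
  qed simp
  have pow: "((\<lambda>t::real. t ^ k / t ^ n) \<longlongrightarrow> (if k = n then 1 else 0)) at_top" if "k \<le> n" for k
  proof (cases "k = n")
    case True
    have "\<forall>\<^sub>F t::real in at_top. 1 = t ^ k / t ^ n"
      using eventually_gt_at_top[of 0] by eventually_elim (simp add: True)
    then show ?thesis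
      using True by (auto intro: Lim_transform_eventually[OF tendsto_const])
  next
    case False
    with that have "k < n" by simp
    then have "((\<lambda>t::real. 1 / t ^ (n - k)) \<longlongrightarrow> 0) at_top"
      by (intro tendsto_divide_0[OF tendsto_const] filterlim_at_top_imp_at_infinity
          filterlim_pow_at_top filterlim_ident) auto
    moreover have "\<forall>\<^sub>F t::real in at_top. 1 / t ^ (n - k) = t ^ k / t ^ n"
      using eventually_gt_at_top[of 0] by eventually_elim (simp add: power_diff that)
    ultimately show ?thesis
      using False by (auto intro: Lim_transform_eventually)
  qed
  have "((\<lambda>t. Re s * (ln (1 + t) / t ^ n) + (\<Sum>k\<le>n. b k * (t ^ k / t ^ n)))
          \<longlongrightarrow> Re s * 0 + (\<Sum>k\<le>n. b k * (if k = n then 1 else 0))) at_top"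
    by (intro tendsto_intros ln pow) auto
  moreover have "Re s * 0 + (\<Sum>k\<le>n. b k * (if k = n then 1 else 0)) = b n"
    by (simp add: if_distrib cong: if_cong)
  ultimately have "((\<lambda>t. Re s * (ln (1 + t) / t ^ n) + (\<Sum>k\<le>n. b k * (t ^ k / t ^ n))) \<longlongrightarrow> b n) at_top"
    by simp
  moreover have "filterlim (\<lambda>t::real. t ^ n) at_top at_top"
    using n by (intro filterlim_pow_at_top filterlim_ident) auto
  \<comment> \<open>\<open>E t\<close> is written as t^n times a bracket whose limit
    \<open>b n\<close> is negative.\<close>
  ultimately have "filterlim (\<lambda>t. (Re s * (ln (1 + t) / t ^ n) + (\<Sum>k\<le>n. b k * (t ^ k / t ^ n))) * t ^ n) at_bot at_top"
    using neg by (intro filterlim_tendsto_neg_mult_at_bot[of _ "b n"]) (auto simp: b_def)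
  moreover have "\<forall>\<^sub>F t in at_top. (Re s * (ln (1 + t) / t ^ n) + (\<Sum>k\<le>n. b k * (t ^ k / t ^ n))) * t ^ n = E t"
    using eventually_gt_at_top[of 0]
    by eventually_elim (simp add: E_def distrib_right sum_distrib_right)
  ultimately have "filterlim E at_bot at_top"
    by (simp cong: filterlim_cong)
  then have "((\<lambda>t. exp (E t)) \<longlongrightarrow> 0) at_top"
    by (rule filterlim_compose[OF exp_at_bot])
  then show ?thesis
    unfolding filterlim_at_bot_mirror by (subst tendsto_norm_zero_iff[symmetric]) (simp only: norm)
qed

section \<open>Integrability over the negative half-line\<close>

lemma continuous_on_PhiC_integrand: "continuous_on {..0} (PhiC_integrand a n s)"
  unfolding PhiC_integrand_def cpowC_def phiC_def fpoly_def
  by (intro continuous_intros) auto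

text \<open>The fundamental theorem for improper integrals speaks of open intervals,
  \<open>PhiC\<close> of \<open>{..0}\<close>; the two sets differ by the null set
  \<open>{0}\<close>.\<close>

lemma set_integrable_einterval_Iic:
  fixes f :: "real \<Rightarrow> 'b::euclidean_space"
  shows "set_integrable lborel (einterval (-\<infinity>) 0) f \<longleftrightarrow> set_integrable lborel {..0} f"
  by (rule set_integrable_discrete_difference[where X = "{0}"]) (auto simp: einterval_iff)

lemma set_integral_einterval_Iic:
  fixes f :: "real \<Rightarrow> 'b::euclidean_space"
  shows "(LBINT x=-\<infinity>..0. f x) = (LINT x:{..0}|lborel. f x)"
  unfolding interval_lebesgue_integral_def
  by simp (rule set_integral_discrete_difference[where X = "{0}"], auto simp: einterval_iff)

text \<open>This is the integrable majorant for all the integrands; the antiderivative 1/(1-x) runs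
  from 0 at minus infinity to 1 at 0.\<close>

lemma set_integrable_inverse_square:
  "set_integrable lborel {..0::real} (\<lambda>x. 1 / (1 - x) ^ 2)"
proof -
  have "set_integrable lborel (einterval (-\<infinity>) 0) (\<lambda>x::real. 1 / (1 - x) ^ 2)"
  proof (rule interval_integral_FTC_nonneg(1)[where F = "\<lambda>x. 1 / (1 - x)" and A = 0 and B = 1])
    fix x :: real assume "- \<infinity> < ereal x" "ereal x < 0"
    then have "x < 0" by simp
    then show "((\<lambda>x. 1 / (1 - x)) has_real_derivative 1 / (1 - x) ^ 2) (at x)"
      by (auto intro!: derivative_eq_intros simp: power2_eq_square)
    show "isCont (\<lambda>x. 1 / (1 - x) ^ 2) x"
      using \<open>x < 0\<close> by (intro continuous_intros) auto
  next
    have "((\<lambda>x::real. 1 / (1 - x)) \<longlongrightarrow> 0) at_bot" by real_asymp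
    then show "(((\<lambda>x::real. 1 / (1 - x)) \<circ> real_of_ereal) \<longlongrightarrow> 0) (at_right (- \<infinity>))"
      by (simp add: ereal_tendsto_simps)
    have "((\<lambda>x::real. 1 / (1 - x)) \<longlongrightarrow> 1) (at_left 0)" by real_asymp
    then show "(((\<lambda>x::real. 1 / (1 - x)) \<circ> real_of_ereal) \<longlongrightarrow> 1) (at_left 0)"
      by (simp add: ereal_tendsto_simps zero_ereal_def)
  qed auto
  then show ?thesis
    by (simp only: set_integrable_einterval_Iic)
qed

lemma cpowC_add: "cpowC x (s + t) = cpowC x s * cpowC x t"
  by (simp add: cpowC_def distrib_right exp_add)

lemma cpowC_of_nat: "x \<le> 0 \<Longrightarrow> cpowC x (of_nat m) = (1 - complex_of_real x) ^ m"
  by (simp add: cpowC_def exp_of_nat_mult exp_of_real)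

text \<open>Raising the exponent by 2 leaves a function that is still continuous with limit 0 at
  minus infinity, hence bounded. The integrand at \<open>s\<close> is this bounded function divided
  by (1-x)^2.\<close>

lemma set_integrable_PhiC_integrand:
  assumes "n \<ge> 1" "(-1) ^ n * Re (a n) < 0"
  shows "set_integrable lborel {..0} (PhiC_integrand a n s)"
proof -
  let ?g = "PhiC_integrand a n (s + 2)"
  obtain N where N: "norm (?g x) < 1" if "x \<le> N" for x
    using tendstoD[OF PhiC_integrand_tendsto_0[of n a "s + 2"], of 1] assms
    by (auto simp: eventually_at_bot_linorder)
  have "compact (?g ` {N..0})"
    by (intro compact_continuous_image continuous_on_subset[OF continuous_on_PhiC_integrand]) auto
  then obtain B where B: "norm (?g x) \<le> B" if "x \<in> {N..0}" for x
    by (meson bounded_iff compact_imp_bounded imageI)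
  have bound: "norm (?g x) \<le> max 1 B" if "x \<le> 0" for x
    using N[of x] B[of x] that by (cases "x \<le> N") (auto simp: le_max_iff_disj)
  have eq: "PhiC_integrand a n s x = ?g x / (1 - of_real x) ^ 2" if "x \<le> 0" for x
  proof -
    have "1 - complex_of_real x \<noteq> 0"
      using that by (simp add: complex_eq_iff)
    then show ?thesis
      using that cpowC_of_nat[of x 2] by (simp add: PhiC_integrand_def cpowC_add)
  qed
  have "set_integrable lborel {..0} (\<lambda>x. max 1 B * (1 / (1 - x) ^ 2))"
    by (intro set_integrable_mult_right set_integrable_inverse_square)
  then show ?thesis
  proof (rule set_integrable_bound)
    show "set_borel_measurable lborel {..0} (PhiC_integrand a n s)"
      unfolding set_borel_measurable_def
      by (simp, rule borel_measurable_continuous_on_indicator[OF _ continuous_on_PhiC_integrand]) simp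
    have "norm (PhiC_integrand a n s x) \<le> max 1 B * (1 / (1 - x) ^ 2)" if "x \<le> 0" for x
    proof -
      have "norm (1 - complex_of_real x) = 1 - x"
        using that norm_of_real[of "1 - x", where ?'a = complex] by simp
      then show ?thesis
        using bound[OF that] by (simp add: eq[OF that] norm_divide norm_power divide_right_mono)
    qed
    then show "AE x in lborel. x \<in> {..0} \<longrightarrow> norm (PhiC_integrand a n s x) \<le> norm (max 1 B * (1 / (1 - x) ^ 2))"
      by (intro AE_I2) (auto intro: order_trans[OF _ abs_ge_self])
  qed
qed

section \<open>Derivatives and integration by parts\<close>

lemma sum_ccoef_one_minus:
  fixes a :: "nat \<Rightarrow> 'a::comm_ring_1"
  shows "(\<Sum>m<n. (-1) ^ m * ccoef a n m * (1 - x) ^ m) = (\<Sum>j<n. of_nat (Suc j) * a (Suc j) * x ^ j)"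
proof -
  \<comment> \<open>The \<open>ccoef a n m\<close> are the Taylor coefficients of f' at 1; the signs
    turn powers of \<open>x - 1\<close> into powers of \<open>1 - x\<close>.\<close>
  have "(\<Sum>m<n. (-1) ^ m * ccoef a n m * (1 - x) ^ m) = (\<Sum>m<n. ccoef a n m * (x - 1) ^ m)"
    by (intro sum.cong refl) (metis (no_types, lifting) minus_diff_eq mult.assoc mult.commute power_minus)
  also have "\<dots> = (\<Sum>j<n. of_nat (Suc j) * a (Suc j) * x ^ j)"
    unfolding sum_ccoef_mult using binomial_ring[of "x - 1" 1] by simp
  finally show ?thesis .
qed

lemma phiC_has_vector_derivative:
  "(phiC a n has_vector_derivative
      (\<Sum>m<n. (-1) ^ m * ccoef a n m * (1 - complex_of_real x) ^ m * phiC a n x)) (at x within S)"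
proof -
  have "(fpoly a n has_field_derivative (\<Sum>k\<le>n. a k * (of_nat k * z ^ (k - 1)))) (at z)" for z :: complex
    unfolding fpoly_def[abs_def] by (auto intro!: derivative_eq_intros sum.cong)
  moreover have "(\<Sum>k\<le>n. a k * (of_nat k * z ^ (k - 1))) = (\<Sum>j<n. of_nat (Suc j) * a (Suc j) * z ^ j)" for z
    by (simp add: sum.atMost_shift mult_ac)
  ultimately have "(fpoly a n has_field_derivative (\<Sum>j<n. of_nat (Suc j) * a (Suc j) * z ^ j)) (at z)" for z
    by metis
  then have "((\<lambda>z. exp (fpoly a n z)) has_field_derivative
      exp (fpoly a n z) * (\<Sum>m<n. (-1) ^ m * ccoef a n m * (1 - z) ^ m)) (at z)" for z :: complex
    unfolding sum_ccoef_one_minus by (auto intro!: derivative_eq_intros)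
  from has_vector_derivative_real_field[OF this] show ?thesis
    unfolding phiC_def by (simp add: sum_distrib_left mult_ac)
qed

lemma cpowC_has_vector_derivative:
  assumes "x < 1"
  shows "((\<lambda>x. cpowC x s) has_vector_derivative - s * cpowC x (s - 1)) (at x within S)"
proof -
  have "((\<lambda>x. ln (1 - x)) has_real_derivative - 1 / (1 - x)) (at x within S)"
    using assms by (auto intro!: derivative_eq_intros)
  then have "((\<lambda>x. s * complex_of_real (ln (1 - x))) has_vector_derivative s * of_real (- 1 / (1 - x))) (at x within S)"
    by (intro has_vector_derivative_mult_right has_vector_derivative_of_real)
  from field_vector_diff_chain_within[OF this, of exp] 
  have "((\<lambda>x. cpowC x s) has_vector_derivative s * of_real (- 1 / (1 - x)) * cpowC x s) (at x within S)"
    by (simp add: cpowC_def o_def DERIV_exp has_field_derivative_at_within)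
  \<comment> \<open>The inner derivative contributes 1/(1-x), which lowers the exponent by
    one.\<close>
  moreover have "cpowC x (s - 1) = cpowC x s / of_real (1 - x)"
    using assms by (simp add: cpowC_def exp_diff left_diff_distrib exp_of_real)
  ultimately show ?thesis by simp
qed

lemma
  fixes g :: "'i \<Rightarrow> real \<Rightarrow> 'b::{banach, second_countable_topology}"
  assumes "\<And>i. i \<in> I \<Longrightarrow> set_integrable M A (g i)"
  shows set_integrable_sum: "set_integrable M A (\<lambda>x. \<Sum>i\<in>I. g i x)"
    and set_integral_sum: "(LINT x:A|M. \<Sum>i\<in>I. g i x) = (\<Sum>i\<in>I. LINT x:A|M. g i x)"
  using assms by (simp_all add: set_integrable_def set_lebesgue_integral_def scaleR_sum_right)

lemma PhiC_functional_equation: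
  assumes "n \<ge> 1" "(-1) ^ n * Re (a n) < 0"
  shows "exp (a 0) + s * PhiC a n (s - 1) = (\<Sum>m<n. (-1) ^ m * ccoef a n m * PhiC a n (s + of_nat m))"
proof -
  let ?I = "\<lambda>s. PhiC_integrand a n s"
  \<comment> \<open>The derivative of \<open>?I s\<close>: the sum comes from differentiating
    \<open>phiC\<close>, with each (1-x)^m absorbed into the exponent, and the last term from
    differentiating \<open>cpowC\<close>.\<close>
  let ?f = "\<lambda>x. (\<Sum>m<n. (-1) ^ m * ccoef a n m * ?I (s + of_nat m) x) - s * ?I (s - 1) x"
  have int: "set_integrable lborel {..0} (?I s)" for s
    using assms by (rule set_integrable_PhiC_integrand)
  have deriv: "(?I s has_vector_derivative ?f x) (at x)" if "x \<le> 0" for x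
  proof -
    have "((\<lambda>x. cpowC x s * phiC a n x) has_vector_derivative
        cpowC x s * (\<Sum>m<n. (-1) ^ m * ccoef a n m * (1 - complex_of_real x) ^ m * phiC a n x) +
        - s * cpowC x (s - 1) * phiC a n x) (at x)"
      using that by (intro has_vector_derivative_mult phiC_has_vector_derivative cpowC_has_vector_derivative) simp
    then show ?thesis
      using that by (simp add: PhiC_integrand_def[abs_def] cpowC_add cpowC_of_nat sum_distrib_left mult_ac)
  qed
  have f_int: "set_integrable lborel {..0} ?f"
    by (intro set_integral_diff(1) set_integrable_sum set_integrable_mult_right int)
  have "isCont ?f x" if "x < 0" for x
  proof -
    have "continuous_on {..<0} ?f"
      by (intro continuous_intros continuous_on_subset[OF continuous_on_PhiC_integrand]) auto
    then show ?thesis using that by (simp add: continuous_on_eq_continuous_at)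
  qed
  moreover have "(?I s \<longlongrightarrow> 0) at_bot"
    using assms by (rule PhiC_integrand_tendsto_0)
  \<comment> \<open>This boundary value at 0 is the source of the constant term of the equation; the
    one at minus infinity is 0.\<close>
  moreover have "(?I s \<longlongrightarrow> exp (a 0)) (at_left 0)"
  proof -
    have "isCont (?I s) 0"
      using deriv[of 0] by (intro has_vector_derivative_continuous) simp
    moreover have "?I s 0 = exp (a 0)"
      by (simp add: PhiC_integrand_def cpowC_def phiC_def fpoly_def sum.atMost_shift)
    ultimately show ?thesis
      by (metis isContD filterlim_at_split)
  qed
  ultimately have "(LBINT x=-\<infinity>..0. ?f x) = exp (a 0) - 0"
    using f_int[folded set_integrable_einterval_Iic] deriv
    by (intro interval_integral_FTC_integrable[where F = "?I s"])
       (auto simp: ereal_tendsto_simps zero_ereal_def)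
  also have "(LBINT x=-\<infinity>..0. ?f x) = (LINT x:{..0}|lborel. ?f x)"
    by (rule set_integral_einterval_Iic)
  also have "\<dots> = (LINT x:{..0}|lborel. \<Sum>m<n. (-1) ^ m * ccoef a n m * ?I (s + of_nat m) x)
      - (LINT x:{..0}|lborel. s * ?I (s - 1) x)"
    by (intro set_integral_diff(2) set_integrable_sum set_integrable_mult_right int)
  also have "\<dots> = (\<Sum>m<n. (-1) ^ m * ccoef a n m * PhiC a n (s + of_nat m)) - s * PhiC a n (s - 1)"
    using int by (simp add: set_integral_sum PhiC_def)
  finally show ?thesis
    by (simp add: algebra_simps)
qed

subsection \<open>The \<open>p\<close>-adic case\<close>

definition Sstep :: "('a::field_char_0 \<Rightarrow> 'a) \<Rightarrow> 'a \<Rightarrow> 'a" where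
  "Sstep \<psi> x = \<psi> x - x * \<psi> (x - 1)"

text \<open>By the binomial theorem the left side is (1-S)^N applied to \<open>\<psi>\<close>, and
  1-S sends \<open>\<psi>\<close> to x \<psi>(x-1); iterating it builds the falling factorial. In
  the induction Pascal's rule gives (1-S)^(N+1) \<psi> = (1-S)^N \<psi> - (1-S)^N (S
  \<psi>).\<close>

lemma sum_Sstep_funpow:
  "(\<Sum>m\<le>N. of_nat (N choose m) * ((-1) ^ m * (Sstep ^^ m) \<psi> x)) =
     fact N * (x gchoose N) * \<psi> (x - of_nat N)"
proof (induction N arbitrary: \<psi>)
  case 0
  then show ?case by simp
next
  case (Suc N)
  define g where "g m = (-1) ^ m * (Sstep ^^ m) \<psi> x" for m
  have "(\<Sum>m\<le>Suc N. of_nat (Suc N choose m) * g m) =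
      g 0 + (\<Sum>m\<le>N. of_nat (N choose Suc m) * g (Suc m)) + (\<Sum>m\<le>N. of_nat (N choose m) * g (Suc m))"
    by (subst sum.atMost_Suc_shift) (simp add: sum.distrib algebra_simps)
  also have "g 0 + (\<Sum>m\<le>N. of_nat (N choose Suc m) * g (Suc m)) = (\<Sum>m\<le>Suc N. of_nat (N choose m) * g m)"
    by (subst sum.atMost_Suc_shift) simp
  also have "\<dots> = (\<Sum>m\<le>N. of_nat (N choose m) * g m)"
    by simp
  also have "(\<Sum>m\<le>N. of_nat (N choose m) * g (Suc m)) =
      - (\<Sum>m\<le>N. of_nat (N choose m) * ((-1) ^ m * (Sstep ^^ m) (Sstep \<psi>) x))"
    by (simp add: g_def funpow_swap1 sum_negf)
  finally have *: "(\<Sum>m\<le>Suc N. of_nat (Suc N choose m) * g m) =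
      fact N * (x gchoose N) * \<psi> (x - of_nat N) - fact N * (x gchoose N) * Sstep \<psi> (x - of_nat N)"
    using Suc.IH[of \<psi>] Suc.IH[of "Sstep \<psi>"] by (simp add: g_def)
  have "(of_nat (Suc N)) * (x gchoose Suc N) = (x gchoose N) * (x - of_nat N)"
    using gbinomial_mult_1[of x N] by (simp add: algebra_simps)
  then have "fact (Suc N) * (x gchoose Suc N) = fact N * (x gchoose N) * (x - of_nat N)"
    by (simp only: fact_Suc of_nat_mult of_nat_Suc mult_ac)
  then have "fact (Suc N) * (x gchoose Suc N) * \<psi> (x - of_nat (Suc N)) =
      fact N * (x gchoose N) * \<psi> (x - of_nat N) - fact N * (x gchoose N) * Sstep \<psi> (x - of_nat N)"
    by (simp only: Sstep_def of_nat_Suc) (simp add: algebra_simps)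
  then show ?case
    using * unfolding g_def by (simp only:)
qed

lemma gchoose_minus_one: "((-1) :: 'a::field_char_0) gchoose k = (-1) ^ k"
  using gbinomial_minus[of "1::'a" k] by (simp flip: binomial_gbinomial)

section \<open>Absolute value and convergence in C_p\<close>

locale Cp_field =
  fixes p :: nat and absv :: "'a::field_char_0 \<Rightarrow> real"
  assumes Cp: "is_Cp p absv"
begin

lemma prime_p: "prime p"
  using Cp by (simp add: is_Cp_def)

lemma
  shows absv_nonneg [simp]: "0 \<le> absv x"
    and absv_eq_0 [simp]: "absv x = 0 \<longleftrightarrow> x = 0"
    and absv_mult: "absv (x * y) = absv x * absv y"
    and absv_add: "absv (x + y) \<le> max (absv x) (absv y)"
    and absv_p: "absv (of_nat p) = 1 / real p"
  using Cp by (auto simp: is_Cp_def is_nonarch_abs_def)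

lemma pcauchy_imp_pconv: "pcauchy absv X \<Longrightarrow> \<exists>L. pconv absv X L"
  using Cp by (simp add: is_Cp_def)

lemma absv_0 [simp]: "absv 0 = 0"
  by simp

lemma absv_1 [simp]: "absv 1 = 1"
  using absv_mult[of 1 1] by simp

lemma absv_minus [simp]: "absv (- x) = absv x"
proof -
  have "absv (-1) * absv (-1) = 1"
    using absv_mult[of "-1" "-1"] by simp
  then have "absv (-1) = 1"
    using absv_nonneg[of "-1"] by (metis abs_of_nonneg abs_mult_self_eq real_sqrt_abs2 real_sqrt_one)
  then show ?thesis
    using absv_mult[of "-1" x] by simp
qed

lemma absv_triangle: "absv (x + y) \<le> absv x + absv y"
  by (rule order_trans[OF absv_add]) simp

lemma absv_diff: "absv (x - y) \<le> max (absv x) (absv y)"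
  using absv_add[of x "- y"] by simp

lemma absv_minus_commute: "absv (x - y) = absv (y - x)"
  using absv_minus[of "x - y"] by simp

lemma absv_power: "absv (x ^ k) = absv x ^ k"
  by (induction k) (simp_all add: absv_mult)

lemma absv_sum_le:
  assumes "0 \<le> B" "\<And>i. i \<in> I \<Longrightarrow> absv (g i) \<le> B"
  shows "absv (sum g I) \<le> B"
  using assms(2)
proof (induction I rule: infinite_finite_induct)
  case (insert i I)
  then show ?case
    using absv_add[of "g i" "sum g I"] by (simp add: max_def split: if_splits) (smt (verit) insertI1)
qed (use assms(1) in auto)

lemma absv_of_nat_le: "absv (of_nat k) \<le> 1"
proof (induction k)
  case (Suc k)
  then show ?case using absv_add[of 1 "of_nat k"] by simp
qed simp

lemma absv_of_int_le: "absv (of_int k) \<le> 1"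
  by (cases k rule: int_cases2) (simp_all add: absv_of_nat_le)

text \<open>This turns \<open>pconv\<close> into a limit of real numbers, so that the limit rules
  for real sequences apply.\<close>

lemma pconv_iff: "pconv absv X L \<longleftrightarrow> (\<lambda>k. absv (X k - L)) \<longlonglongrightarrow> 0"
  by (simp add: pconv_def lim_sequentially)

lemma pconv_const: "pconv absv (\<lambda>_. c) c"
  by (simp add: pconv_iff)

lemma pconv_add:
  assumes "pconv absv X L" "pconv absv Y M"
  shows "pconv absv (\<lambda>k. X k + Y k) (L + M)"
  unfolding pconv_iff
proof (rule tendsto_0_le[where K = 1])
  show "(\<lambda>k. absv (X k - L) + absv (Y k - M)) \<longlonglongrightarrow> 0"
    using tendsto_add[OF assms[unfolded pconv_iff]] by simp
  show "\<forall>\<^sub>F k in sequentially. norm (absv (X k + Y k - (L + M))) \<le> norm (absv (X k - L) + absv (Y k - M)) * 1"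
  proof (rule always_eventually, rule allI)
    fix k
    show "norm (absv (X k + Y k - (L + M))) \<le> norm (absv (X k - L) + absv (Y k - M)) * 1"
      using absv_triangle[of "X k - L" "Y k - M"] by (simp add: add_diff_add)
  qed
qed

lemma pconv_mult:
  assumes "pconv absv X L" "pconv absv Y M"
  shows "pconv absv (\<lambda>k. X k * Y k) (L * M)"
  unfolding pconv_iff
proof (rule tendsto_0_le[where K = 1])
  let ?x = "\<lambda>k. absv (X k - L)" and ?y = "\<lambda>k. absv (Y k - M)"
  have "(\<lambda>k. ?x k * ?y k + (absv L * ?y k + ?x k * absv M)) \<longlonglongrightarrow> 0 * 0 + (absv L * 0 + 0 * absv M)"
    using assms[unfolded pconv_iff] by (intro tendsto_intros)
  then show "(\<lambda>k. ?x k * ?y k + (absv L * ?y k + ?x k * absv M)) \<longlonglongrightarrow> 0"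
    by simp
  show "\<forall>\<^sub>F k in sequentially. norm (absv (X k * Y k - L * M))
          \<le> norm (?x k * ?y k + (absv L * ?y k + ?x k * absv M)) * 1"
  proof (rule always_eventually, rule allI)
    fix k
    have "X k * Y k - L * M = (X k - L) * (Y k - M) + (L * (Y k - M) + (X k - L) * M)"
      by (simp add: algebra_simps)
    then have "absv (X k * Y k - L * M) = absv ((X k - L) * (Y k - M) + (L * (Y k - M) + (X k - L) * M))"
      by (rule arg_cong)
    also have "\<dots> \<le> absv ((X k - L) * (Y k - M)) + (absv (L * (Y k - M)) + absv ((X k - L) * M))"
      by (rule order_trans[OF absv_triangle add_left_mono[OF absv_triangle]])
    finally show "norm (absv (X k * Y k - L * M))
        \<le> norm (?x k * ?y k + (absv L * ?y k + ?x k * absv M)) * 1"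
      by (simp add: absv_mult)
  qed
qed

lemma pconv_diff:
  assumes "pconv absv X L" "pconv absv Y M"
  shows "pconv absv (\<lambda>k. X k - Y k) (L - M)"
  using pconv_add[OF assms(1) pconv_mult[OF pconv_const[of "-1"] assms(2)]] by simp

lemma pconv_sum:
  assumes "\<And>i. i \<in> I \<Longrightarrow> pconv absv (X i) (L i)"
  shows "pconv absv (\<lambda>k. \<Sum>i\<in>I. X i k) (\<Sum>i\<in>I. L i)"
  using assms by (induction I rule: infinite_finite_induct) (simp_all add: pconv_add pconv_const)

lemma pconv_prod:
  assumes "\<And>i. i \<in> I \<Longrightarrow> pconv absv (X i) (L i)"
  shows "pconv absv (\<lambda>k. \<Prod>i\<in>I. X i k) (\<Prod>i\<in>I. L i)"
  using assms by (induction I rule: infinite_finite_induct) (simp_all add: pconv_mult pconv_const)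

lemma pconv_unique:
  assumes "pconv absv X L" "pconv absv X M"
  shows "L = M"
proof -
  have "pconv absv (\<lambda>k. 0) (L - M)"
    using pconv_diff[OF assms] by simp
  then show ?thesis
    by (simp add: pconv_iff LIMSEQ_const_iff)
qed

text \<open>Once \<open>X k\<close> is nearer to \<open>L\<close> than \<open>absv L\<close>, the
  ultrametric inequality forces \<open>absv L \<le> absv (X k)\<close>. Bounds on the naturals pass
  to \<open>Zp absv\<close> in this way.\<close>

lemma pconv_absv_le:
  assumes "pconv absv X L" "\<And>k. absv (X k) \<le> B"
  shows "absv L \<le> B"
proof (rule ccontr)
  assume "\<not> absv L \<le> B"
  moreover have "0 \<le> B" using assms(2)[of 0] absv_nonneg[of "X 0"] by linarith
  ultimately obtain k where "absv (X k - L) < absv L"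
    using assms(1) unfolding pconv_def by (metis not_le order.refl le_less_trans)
  moreover have "absv L \<le> max (absv (X k)) (absv (X k - L))"
    using absv_diff[of "X k" "X k - L"] by simp
  ultimately show False
    using assms(2)[of k] \<open>\<not> absv L \<le> B\<close> by linarith
qed

section \<open>Z_p, binomial coefficients and factorials\<close>

lemma Zp_of_int [simp]: "of_int k \<in> Zp absv"
  unfolding Zp_def by (auto intro!: exI[of _ "\<lambda>_. k"] pconv_const)

lemma Zp_of_nat [simp]: "of_nat k \<in> Zp absv"
  using Zp_of_int[of "int k"] by simp

lemma Zp_add [simp]:
  assumes "x \<in> Zp absv" "y \<in> Zp absv"
  shows "x + y \<in> Zp absv"
proof -
  obtain X Y :: "nat \<Rightarrow> int" where "pconv absv (\<lambda>k. of_int (X k)) x" "pconv absv (\<lambda>k. of_int (Y k)) y"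
    using assms unfolding Zp_def by blast
  from pconv_add[OF this] have "pconv absv (\<lambda>k. of_int (X k + Y k)) (x + y)"
    by simp
  then show ?thesis
    unfolding Zp_def mem_Collect_eq by (rule exI[of _ "\<lambda>k. X k + Y k"])
qed

lemma Zp_diff [simp]:
  assumes "x \<in> Zp absv" "y \<in> Zp absv"
  shows "x - y \<in> Zp absv"
proof -
  obtain X Y :: "nat \<Rightarrow> int" where "pconv absv (\<lambda>k. of_int (X k)) x" "pconv absv (\<lambda>k. of_int (Y k)) y"
    using assms unfolding Zp_def by blast
  from pconv_diff[OF this] have "pconv absv (\<lambda>k. of_int (X k - Y k)) (x - y)"
    by simp
  then show ?thesis
    unfolding Zp_def mem_Collect_eq by (rule exI[of _ "\<lambda>k. X k - Y k"])
qed

lemma Zp_1 [simp]: "1 \<in> Zp absv" "- 1 \<in> Zp absv"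
  using Zp_of_int[of 1] Zp_of_int[of "-1"] by simp_all

lemma Zp_nat_limit:
  assumes "x \<in> Zp absv"
  obtains X :: "nat \<Rightarrow> nat" where "pconv absv (\<lambda>k. of_nat (X k)) x"
proof -
  obtain Y :: "nat \<Rightarrow> int" where Y: "pconv absv (\<lambda>k. of_int (Y k)) x"
    using assms by (auto simp: Zp_def)
  \<comment> \<open>Adding p^k |Y k| makes the integer nonnegative and changes it by at most p^(-k)
    in absolute value, so the limit is the same.\<close>
  define X where "X k = nat (Y k + int p ^ k * \<bar>Y k\<bar>)" for k
  have "p > 0" "p > 1" using prime_p prime_gt_1_nat prime_gt_0_nat by auto
  have "1 * \<bar>y\<bar> \<le> int p ^ k * \<bar>y\<bar>" for y k
    using \<open>p > 0\<close> by (intro mult_right_mono) auto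
  then have nn: "0 \<le> Y k + int p ^ k * \<bar>Y k\<bar>" for k
    by (smt (verit))
  have X: "of_nat (X k) = of_int (Y k) + of_nat p ^ k * (of_int \<bar>Y k\<bar> :: 'a)" for k
  proof -
    have "of_nat (X k) = (of_int (int (X k)) :: 'a)" by simp
    also have "int (X k) = Y k + int p ^ k * \<bar>Y k\<bar>" using nn by (simp add: X_def)
    finally show ?thesis by simp
  qed
  have "pconv absv (\<lambda>k. of_nat p ^ k * of_int \<bar>Y k\<bar>) 0"
    unfolding pconv_iff
  proof (rule tendsto_0_le[where K = 1])
    show "(\<lambda>k. (1 / real p) ^ k) \<longlonglongrightarrow> 0"
      using \<open>p > 1\<close> by (intro LIMSEQ_realpow_zero) auto
    show "\<forall>\<^sub>F k in sequentially. norm (absv (of_nat p ^ k * of_int \<bar>Y k\<bar> - 0)) \<le> norm ((1 / real p) ^ k) * 1"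
      using absv_of_int_le
      by (intro always_eventually allI) (simp add: absv_mult absv_power absv_p mult_left_le del: of_int_abs)
  qed
  from pconv_add[OF Y this] have "pconv absv (\<lambda>k. of_nat (X k)) x"
    by (simp add: X)
  then show ?thesis by (rule that)
qed

lemma absv_Zp_le:
  assumes "x \<in> Zp absv"
  shows "absv x \<le> 1"
proof -
  obtain X :: "nat \<Rightarrow> nat" where X: "pconv absv (\<lambda>k. of_nat (X k)) x"
    using Zp_nat_limit[OF assms] .
  show ?thesis
    by (rule pconv_absv_le[OF X absv_of_nat_le])
qed

lemma pconv_gbinomial:
  assumes "pconv absv X x"
  shows "pconv absv (\<lambda>i. X i gchoose k) (x gchoose k)"
  unfolding gbinomial_prod_rev divide_inverse
  by (intro pconv_mult pconv_prod pconv_diff pconv_const assms)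

text \<open>At naturals the binomial coefficient is a natural number; being a polynomial in
  \<open>x\<close>, it is continuous, so the bound survives the limit.\<close>

lemma absv_gbinomial_le:
  assumes "x \<in> Zp absv"
  shows "absv (x gchoose k) \<le> 1"
proof -
  obtain X :: "nat \<Rightarrow> nat" where X: "pconv absv (\<lambda>k. of_nat (X k)) x"
    using Zp_nat_limit[OF assms] .
  show ?thesis
    by (rule pconv_absv_le[OF pconv_gbinomial[OF X]])
       (simp add: absv_of_nat_le flip: binomial_gbinomial)
qed

text \<open>k! is divisible by p^(k div p). This decay is what makes the series for S^y
  converge.\<close>

lemma absv_fact_tendsto_0: "(\<lambda>k. absv (fact k)) \<longlonglongrightarrow> 0"
proof -
  have "p > 0" "p > 1" using prime_p prime_gt_1_nat prime_gt_0_nat by auto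
  have dvd: "p ^ j dvd (fact (p * j) :: nat)" for j
  proof (induction j)
    case (Suc j)
    have "fact (p * Suc j) = p * Suc j * (fact (p * Suc j - 1) :: nat)"
      using \<open>p > 0\<close> fact_reduce[of "p * Suc j", where ?'a = nat] by simp
    moreover have "fact (p * j) dvd (fact (p * Suc j - 1) :: nat)"
      using \<open>p > 0\<close> by (intro fact_dvd) auto
    ultimately have "(p * Suc j) * p ^ j dvd (fact (p * Suc j) :: nat)"
      using Suc by (metis dvd_trans mult_dvd_mono dvd_refl)
    then show ?case
      by (rule dvd_trans[rotated]) simp
  qed simp
  show ?thesis
  proof (rule tendsto_0_le[where K = 1])
    have "filterlim (\<lambda>k. k div p) at_top sequentially"
      using \<open>p > 0\<close> by (rule filterlim_at_top_div_const_nat)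
    moreover have "(\<lambda>k. (1 / real p) ^ k) \<longlonglongrightarrow> 0"
      using \<open>p > 1\<close> by (intro LIMSEQ_realpow_zero) auto
    ultimately show "(\<lambda>k. (1 / real p) ^ (k div p)) \<longlonglongrightarrow> 0"
      by (rule filterlim_compose[rotated])
    show "\<forall>\<^sub>F k in sequentially. norm (absv (fact k)) \<le> norm ((1 / real p) ^ (k div p)) * 1"
    proof (rule always_eventually, rule allI)
      fix k
      have "p ^ (k div p) dvd (fact k :: nat)"
        by (rule dvd_trans[OF dvd]) (auto intro!: fact_dvd)
      then obtain c where "(fact k :: nat) = p ^ (k div p) * c" ..
      then have "(fact k :: 'a) = of_nat p ^ (k div p) * of_nat c"
        by (metis of_nat_fact of_nat_mult of_nat_power)
      then show "norm (absv (fact k)) \<le> norm ((1 / real p) ^ (k div p)) * 1"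
        using absv_of_nat_le[of c] by (simp add: absv_mult absv_power absv_p mult_left_le)
    qed
  qed
qed

section \<open>Infinite sums in C_p\<close>

lemma psum_eqI: "pconv absv (\<lambda>N. \<Sum>k<N. g k) L \<Longrightarrow> psum absv g = L"
  unfolding psum_def by (rule the_equality) (auto intro: pconv_unique)

text \<open>In a complete nonarchimedean field terms tending to 0 suffice, since a block of terms is
  bounded by its largest member.\<close>

lemma pconv_psum:
  assumes "(\<lambda>k. absv (g k)) \<longlonglongrightarrow> 0"
  shows "pconv absv (\<lambda>N. \<Sum>k<N. g k) (psum absv g)"
proof -
  have "pcauchy absv (\<lambda>N. \<Sum>k<N. g k)"
    unfolding pcauchy_def
  proof (intro allI impI)
    fix e :: real assume "e > 0"
    \<comment> \<open>Halving \<open>e\<close> makes up for the weak inequality in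
      \<open>absv_sum_le\<close>.\<close>
    then obtain N where N: "absv (g k) < e / 2" if "k \<ge> N" for k
      using LIMSEQ_D[OF assms, of "e / 2"] by auto
    have le: "absv ((\<Sum>k<l. g k) - (\<Sum>k<m. g k)) < e" if "N \<le> m" "m \<le> l" for m l
    proof -
      have "(\<Sum>k<l. g k) - (\<Sum>k<m. g k) = sum g ({..<l} - {..<m})"
        using that by (subst sum_diff) auto
      also have "absv \<dots> \<le> e / 2"
        using \<open>e > 0\<close> N that by (intro absv_sum_le) (auto intro: less_imp_le)
      finally show ?thesis using \<open>e > 0\<close> by simp
    qed
    have "absv ((\<Sum>k<m. g k) - (\<Sum>k<l. g k)) < e" if "N \<le> m" "N \<le> l" for m l
      using le[of l m] le[of m l] that absv_minus_commute by (cases "m \<le> l") auto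
    then show "\<exists>N. \<forall>k\<ge>N. \<forall>l\<ge>N. absv ((\<Sum>k<k. g k) - (\<Sum>k<l. g k)) < e"
      by blast
  qed
  then obtain L where L: "pconv absv (\<lambda>N. \<Sum>k<N. g k) L"
    using pcauchy_imp_pconv by blast
  then show ?thesis
    using psum_eqI[OF L] by simp
qed

lemma psum_add:
  assumes "(\<lambda>k. absv (g k)) \<longlonglongrightarrow> 0" "(\<lambda>k. absv (h k)) \<longlonglongrightarrow> 0"
  shows "psum absv (\<lambda>k. g k + h k) = psum absv g + psum absv h"
  using pconv_add[OF pconv_psum[OF assms(1)] pconv_psum[OF assms(2)]]
  by (intro psum_eqI) (simp add: sum.distrib)

lemma psum_cmult:
  assumes "(\<lambda>k. absv (g k)) \<longlonglongrightarrow> 0"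
  shows "psum absv (\<lambda>k. c * g k) = c * psum absv g"
  using pconv_mult[OF pconv_const pconv_psum[OF assms]]
  by (intro psum_eqI) (simp add: sum_distrib_left)

lemma psum_sum:
  assumes "\<And>i. i \<in> I \<Longrightarrow> (\<lambda>k. absv (g i k)) \<longlonglongrightarrow> 0"
  shows "psum absv (\<lambda>k. \<Sum>i\<in>I. g i k) = (\<Sum>i\<in>I. psum absv (g i))"
proof (rule psum_eqI)
  have "pconv absv (\<lambda>N. \<Sum>i\<in>I. \<Sum>k<N. g i k) (\<Sum>i\<in>I. psum absv (g i))"
    by (intro pconv_sum pconv_psum assms)
  also have "(\<lambda>N. \<Sum>i\<in>I. \<Sum>k<N. g i k) = (\<lambda>N. \<Sum>k<N. \<Sum>i\<in>I. g i k)"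
    by (intro ext sum.swap)
  finally show "pconv absv (\<lambda>N. \<Sum>k<N. \<Sum>i\<in>I. g i k) (\<Sum>i\<in>I. psum absv (g i))" .
qed

lemma psum_Suc:
  assumes "(\<lambda>k. absv (g (Suc k))) \<longlonglongrightarrow> 0"
  shows "psum absv g = g 0 + psum absv (\<lambda>k. g (Suc k))"
proof (rule psum_eqI)
  have "pconv absv (\<lambda>N. \<Sum>k<Suc N. g k) (g 0 + psum absv (\<lambda>k. g (Suc k)))"
    using pconv_add[OF pconv_const pconv_psum[OF assms]] by (simp only: sum.lessThan_Suc_shift)
  then show "pconv absv (\<lambda>N. \<Sum>k<N. g k) (g 0 + psum absv (\<lambda>k. g (Suc k)))"
    unfolding pconv_iff by (rule LIMSEQ_imp_Suc)
qed

section \<open>The operators S^y on bounded functions\<close>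

definition bounded_on_Zp :: "('a \<Rightarrow> 'a) \<Rightarrow> bool" where
  "bounded_on_Zp \<psi> \<longleftrightarrow> (\<exists>B. \<forall>x\<in>Zp absv. absv (\<psi> x) \<le> B)"

text \<open>Both binomial factors have absolute value at most 1 and \<open>\<psi>\<close> is
  bounded, so the factorial drives the terms to 0.\<close>

lemma Sop_terms_tendsto_0:
  assumes "bounded_on_Zp \<psi>" "x \<in> Zp absv" "y \<in> Zp absv"
  shows "(\<lambda>k. absv ((-1) ^ k * fact k * (y gchoose k) * (x gchoose k) * \<psi> (x - of_nat k))) \<longlonglongrightarrow> 0"
proof -
  obtain B where B: "absv (\<psi> z) \<le> B" if "z \<in> Zp absv" for z
    using assms(1) by (auto simp: bounded_on_Zp_def)
  show ?thesis
  proof (rule tendsto_0_le[OF absv_fact_tendsto_0, where K = B], rule always_eventually, rule allI)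
    fix k
    have "absv (y gchoose k) * absv (x gchoose k) * absv (\<psi> (x - of_nat k)) \<le> 1 * 1 * B"
      using assms by (intro mult_mono absv_gbinomial_le B) auto
    then have "absv (fact k) * (absv (y gchoose k) * absv (x gchoose k) * absv (\<psi> (x - of_nat k))) \<le> absv (fact k) * B"
      by (intro mult_left_mono) auto
    then show "norm (absv ((-1) ^ k * fact k * (y gchoose k) * (x gchoose k) * \<psi> (x - of_nat k)))
        \<le> norm (absv (fact k)) * B"
      by (simp add: absv_mult absv_power mult_ac)
  qed
qed

lemma bounded_on_Zp_Sstep:
  assumes "bounded_on_Zp \<psi>"
  shows "bounded_on_Zp (Sstep \<psi>)"
proof -
  obtain B where B: "absv (\<psi> z) \<le> B" if "z \<in> Zp absv" for z
    using assms(1) by (auto simp: bounded_on_Zp_def)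
  have "absv (Sstep \<psi> x) \<le> B" if "x \<in> Zp absv" for x
  proof -
    have "absv x * absv (\<psi> (x - 1)) \<le> 1 * B"
      using that by (intro mult_mono absv_Zp_le B) auto
    then show ?thesis
      using B[OF that] absv_diff[of "\<psi> x" "x * \<psi> (x - 1)"] by (simp add: Sstep_def absv_mult)
  qed
  then show ?thesis by (auto simp: bounded_on_Zp_def)
qed

lemma bounded_on_Zp_Sstep_funpow: "bounded_on_Zp \<psi> \<Longrightarrow> bounded_on_Zp ((Sstep ^^ m) \<psi>)"
  by (induction m) (auto intro: bounded_on_Zp_Sstep)

text \<open>The series are not equal term by term: Pascal's rule in \<open>y\<close> makes them
  agree only after part of the sum is shifted by one index.\<close>

lemma Sop_add_1:
  assumes "bounded_on_Zp \<psi>" "x \<in> Zp absv" "y \<in> Zp absv"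
  shows "Sop absv (y + 1) \<psi> x = Sop absv y (Sstep \<psi>) x"
proof -
  define T where "T y \<psi> k = (-1) ^ k * fact k * (y gchoose k) * (x gchoose k) * \<psi> (x - of_nat k)" for y \<psi> k
  define U where "U k = T (y + 1) \<psi> k - T y \<psi> k" for k
  have T0: "(\<lambda>k. absv (T y \<psi> k)) \<longlonglongrightarrow> 0" if "y \<in> Zp absv" "bounded_on_Zp \<psi>" for y \<psi>
    unfolding T_def using assms that by (intro Sop_terms_tendsto_0)
  \<comment> \<open>Pascal's rule leaves \<open>y gchoose k\<close>, and absorbing
    \<open>Suc k\<close> into \<open>x gchoose Suc k\<close> yields the factor
    \<open>x - of_nat k\<close> of the second term of \<open>Sstep\<close>. As
    \<open>U 0 = 0\<close>, shifting the index loses nothing.\<close>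
  have U: "U (Suc k) = T y (Sstep \<psi>) k - T y \<psi> k" for k
  proof -
    have *: "(of_nat (Suc k)) * (x gchoose Suc k) = (x gchoose k) * (x - of_nat k)"
      using gbinomial_mult_1[of x k] by (simp add: algebra_simps)
    have "U (Suc k) = (-1) ^ Suc k * fact (Suc k) * (y gchoose k) * (x gchoose Suc k) * \<psi> (x - of_nat (Suc k))"
      unfolding U_def T_def gbinomial_Suc_Suc by (simp add: algebra_simps)
    also have "\<dots> = (-1) ^ Suc k * fact k * (y gchoose k) * ((of_nat (Suc k)) * (x gchoose Suc k)) * \<psi> (x - of_nat (Suc k))"
      by (simp only: fact_Suc of_nat_mult mult_ac of_nat_Suc)
    also have "\<dots> = T y (Sstep \<psi>) k - T y \<psi> k"
      unfolding * T_def Sstep_def by (simp add: algebra_simps)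
    finally show ?thesis .
  qed
  have U0: "U 0 = 0"
    by (simp add: U_def T_def)
  have UT: "(\<lambda>k. absv (U (Suc k))) \<longlonglongrightarrow> 0"
  proof -
    have "pconv absv (T y (Sstep \<psi>)) 0" "pconv absv (T y \<psi>) 0"
      unfolding pconv_iff using T0 assms bounded_on_Zp_Sstep by auto
    from pconv_diff[OF this] show ?thesis unfolding pconv_iff U by simp
  qed
  then have "(\<lambda>k. absv (U k)) \<longlonglongrightarrow> 0"
    by (rule LIMSEQ_imp_Suc)
  then have "psum absv (\<lambda>k. T y \<psi> k + U k) = psum absv (T y \<psi>) + psum absv U"
    using T0 assms by (intro psum_add) auto
  also have "psum absv U = psum absv (\<lambda>k. U (Suc k))"
    using psum_Suc[OF UT] U0 by simp
  also have "psum absv (T y \<psi>) + \<dots> = psum absv (\<lambda>k. T y \<psi> k + U (Suc k))"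
    using T0 assms UT by (intro psum_add[symmetric]) auto
  finally have "psum absv (T (y + 1) \<psi>) = psum absv (T y (Sstep \<psi>))"
    by (simp add: U) (simp add: U_def)
  then show ?thesis
    by (simp add: Sop_def T_def[abs_def])
qed

lemma Sop_add_of_nat:
  assumes "bounded_on_Zp \<psi>" "x \<in> Zp absv" "y \<in> Zp absv"
  shows "Sop absv (y + of_nat m) \<psi> x = Sop absv y ((Sstep ^^ m) \<psi>) x"
  using assms
proof (induction m arbitrary: \<psi>)
  case (Suc m)
  have "Sop absv (y + of_nat (Suc m)) \<psi> x = Sop absv ((y + of_nat m) + 1) \<psi> x"
    by (simp add: ac_simps)
  also have "\<dots> = Sop absv (y + of_nat m) (Sstep \<psi>) x"
    using Suc.prems by (intro Sop_add_1) auto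
  also have "\<dots> = Sop absv y ((Sstep ^^ Suc m) \<psi>) x"
    using Suc by (simp add: bounded_on_Zp_Sstep funpow_swap1)
  finally show ?case .
qed simp

lemma Sop_0: "Sop absv 0 \<psi> x = \<psi> x"
proof -
  have "(-1) ^ k * fact k * (0 gchoose k) * (x gchoose k) * \<psi> (x - of_nat k) =
      (if k = 0 then \<psi> x else 0)" for k
    by (cases k) simp_all
  then have "Sop absv 0 \<psi> x = psum absv (\<lambda>k. if k = 0 then \<psi> x else 0)"
    by (simp only: Sop_def)
  also have "\<dots> = \<psi> x"
    by (subst psum_Suc) (auto intro: psum_eqI simp: pconv_iff)
  finally show ?thesis .
qed

lemma Sop_of_nat:
  assumes "bounded_on_Zp \<psi>" "x \<in> Zp absv"
  shows "Sop absv (of_nat m) \<psi> x = (Sstep ^^ m) \<psi> x"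
  using Sop_add_of_nat[of \<psi> x 0 m] assms Zp_of_nat[of 0] by (simp add: Sop_0)

text \<open>At -1 the factor \<open>(-1) gchoose k\<close> cancels the sign, leaving the sum of k!
  (s choose k) \<psi>(-k). The term at \<open>k = 0\<close> is \<open>\<psi> 0\<close>; in the
  others (k+1)(s choose k+1) = s (s-1 choose k) splits off \<open>s\<close>.\<close>

lemma Sop_shift_minus_one:
  assumes "bounded_on_Zp \<psi>" "s \<in> Zp absv"
  shows "Sop absv s (\<lambda>x. \<psi> (x + 1)) (-1) = \<psi> 0 + s * Sop absv (s - 1) \<psi> (-1)"
proof -
  define T where "T y \<psi> k = (-1) ^ k * fact k * (y gchoose k) * ((-1) gchoose k) * \<psi> ((-1) - of_nat k)"
    for y :: 'a and \<psi> :: "'a \<Rightarrow> 'a" and k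
  have T0: "(\<lambda>k. absv (T (s - 1) \<psi> k)) \<longlonglongrightarrow> 0"
    unfolding T_def using assms by (intro Sop_terms_tendsto_0) auto
  have Suc: "T s (\<lambda>x. \<psi> (x + 1)) (Suc k) = s * T (s - 1) \<psi> k" for k
  proof -
    have "T s (\<lambda>x. \<psi> (x + 1)) (Suc k) = fact k * (of_nat (Suc k) * (s gchoose Suc k)) * \<psi> (-1 - of_nat k)"
      by (simp add: T_def gchoose_minus_one algebra_simps flip: power_mult_distrib)
    also have "of_nat (Suc k) * (s gchoose Suc k) = s * (s - 1 gchoose k)"
      by (rule gbinomial_absorption)
    also have "fact k * (s * (s - 1 gchoose k)) * \<psi> (-1 - of_nat k) = s * T (s - 1) \<psi> k"
      by (simp add: T_def gchoose_minus_one algebra_simps flip: power_mult_distrib)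
    finally show ?thesis .
  qed
  have "(\<lambda>k. absv (T s (\<lambda>x. \<psi> (x + 1)) (Suc k))) \<longlonglongrightarrow> 0"
    using tendsto_mult[OF tendsto_const T0, of "absv s"] by (simp add: Suc absv_mult)
  then have "psum absv (T s (\<lambda>x. \<psi> (x + 1))) = T s (\<lambda>x. \<psi> (x + 1)) 0 + psum absv (\<lambda>k. s * T (s - 1) \<psi> k)"
    by (subst psum_Suc) (simp_all only: Suc)
  also have "\<dots> = \<psi> 0 + s * psum absv (T (s - 1) \<psi>)"
    by (simp add: psum_cmult[OF T0]) (simp add: T_def)
  finally show ?thesis
    by (simp only: Sop_def T_def[abs_def])
qed

lemma pcont_on_pconv:
  assumes "pcont_on absv (Zp absv) \<phi>" "x \<in> Zp absv" "\<And>k. X k \<in> Zp absv" "pconv absv X x"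
  shows "pconv absv (\<lambda>k. \<phi> (X k)) (\<phi> x)"
  using assms unfolding pcont_on_def pconv_def by meson

section \<open>The function with prescribed exponential series\<close>

context
  fixes a :: "nat \<Rightarrow> 'a" and n :: nat and \<phi> :: "'a \<Rightarrow> 'a"
  assumes a: "\<And>k. absv (a k) \<le> 1"
    and cont: "pcont_on absv (Zp absv) \<phi>"
    and A: "Aop \<phi> = fps_const (pexp absv (a 0)) * (fps_exp 1 oo (f_fps a n - fps_const (a 0)))"
begin

lemma phi_0: "\<phi> 0 = pexp absv (a 0)"
  using arg_cong[OF A, of "\<lambda>F. fps_nth F 0"] by (simp add: Aop_def fps_compose_nth)

text \<open>Since \<open>Aop\<close> divides by factorials, differentiating
  \<open>Aop \<phi>\<close> shifts the argument of \<open>\<phi>\<close> by one. The recurrence is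
  N! times the N-th coefficient of the differential equation of the exponential.\<close>

lemma phi_Suc:
  "\<phi> (of_nat (Suc N)) =
     (\<Sum>j<n. of_nat (Suc j) * a (Suc j) * (fact j * (of_nat N gchoose j) * \<phi> (of_nat N - of_nat j)))"
proof -
  define h where "h = f_fps a n - fps_const (a 0)"
  have "fps_nth h 0 = 0" by (simp add: h_def f_fps_def)
  then have "fps_deriv (Aop \<phi>) = fps_deriv h * Aop \<phi>"
    unfolding A h_def[symmetric] by (simp add: fps_compose_deriv mult_ac)
  from arg_cong[OF this, of "\<lambda>F. fact N * fps_nth F N"]
  moreover have "fact N * fps_nth (fps_deriv (Aop \<phi>)) N = \<phi> (of_nat (Suc N))"
    by (simp add: Aop_def del: of_nat_Suc)
  ultimately have "\<phi> (of_nat (Suc N)) = (\<Sum>j\<le>N. fact N * (fps_nth (fps_deriv h) j * fps_nth (Aop \<phi>) (N - j)))"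
    by (simp add: fps_mult_nth sum_distrib_left atLeast0AtMost)
  also have "\<dots> = (\<Sum>j\<le>N. if j < n then of_nat (Suc j) * a (Suc j) *
       (fact j * (of_nat N gchoose j) * \<phi> (of_nat N - of_nat j)) else 0)"
  proof (rule sum.cong)
    fix j assume "j \<in> {..N}"
    then have "(of_nat N gchoose j :: 'a) = fact N / (fact j * fact (N - j))"
      by (simp add: binomial_fact flip: binomial_gbinomial)
    then show "fact N * (fps_nth (fps_deriv h) j * fps_nth (Aop \<phi>) (N - j)) =
       (if j < n then of_nat (Suc j) * a (Suc j) *
       (fact j * (of_nat N gchoose j) * \<phi> (of_nat N - of_nat j)) else 0)"
      using \<open>j \<in> {..N}\<close> by (simp add: h_def f_fps_def Aop_def of_nat_diff)
  qed simp
  also have "\<dots> = (\<Sum>j\<in>{..N} \<inter> {..<n}. of_nat (Suc j) * a (Suc j) *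
       (fact j * (of_nat N gchoose j) * \<phi> (of_nat N - of_nat j)))"
    by (subst sum.inter_restrict) auto
  \<comment> \<open>For \<open>N < j < n\<close> the binomial coefficient is 0. The range no longer
    depends on \<open>N\<close>, so the identity can be extended to \<open>Zp absv\<close>.\<close>
  also have "\<dots> = (\<Sum>j<n. of_nat (Suc j) * a (Suc j) * (fact j * (of_nat N gchoose j) * \<phi> (of_nat N - of_nat j)))"
    by (rule sum.mono_neutral_left) (auto simp: binomial_eq_0 simp flip: binomial_gbinomial)
  finally show ?thesis .
qed

text \<open>The recurrence bounds the values of \<open>\<phi>\<close> on \<open>\<nat>\<close>, which makes compactness of \<open>\<int>\<^sub>p\<close> unnecessary.\<close>

lemma absv_phi_of_nat_le: "absv (\<phi> (of_nat N)) \<le> absv (\<phi> 0)"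
proof (induction N rule: less_induct)
  case (less N)
  show ?case
  proof (cases N)
    case (Suc M)
    have "absv (of_nat (Suc j) * a (Suc j) * (fact j * (of_nat M gchoose j) * \<phi> (of_nat M - of_nat j)))
        \<le> absv (\<phi> 0)" for j
    \<comment> \<open>For \<open>j > M\<close> the argument is a negative integer, out of reach of
      the induction hypothesis, but the binomial coefficient vanishes.\<close>
    proof (cases "j \<le> M")
      case True
      have "absv (\<phi> (of_nat M - of_nat j)) \<le> absv (\<phi> 0)"
        using less[of "M - j"] Suc True by (simp add: of_nat_diff)
      moreover have "absv (fact j) \<le> 1"
        using absv_of_nat_le[of "fact j"] by simp
      ultimately have "absv (of_nat (Suc j)) * absv (a (Suc j)) * (absv (fact j) * absv (of_nat M gchoose j)
          * absv (\<phi> (of_nat M - of_nat j))) \<le> 1 * 1 * (1 * 1 * absv (\<phi> 0))"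
        by (intro mult_mono absv_of_nat_le a absv_gbinomial_le) auto
      then show ?thesis by (simp add: absv_mult)
    next
      case False
      then show ?thesis by (simp add: binomial_eq_0 flip: binomial_gbinomial)
    qed
    then show ?thesis
      unfolding Suc phi_Suc by (intro absv_sum_le) auto
  qed simp
qed

lemma bounded_phi: "bounded_on_Zp \<phi>"
  unfolding bounded_on_Zp_def
proof (intro exI ballI)
  fix x assume x: "x \<in> Zp absv"
  obtain X :: "nat \<Rightarrow> nat" where X: "pconv absv (\<lambda>k. of_nat (X k)) x"
    using Zp_nat_limit[OF x] .
  show "absv (\<phi> x) \<le> absv (\<phi> 0)"
    by (rule pconv_absv_le[OF pcont_on_pconv[OF cont x _ X]]) (auto intro: absv_phi_of_nat_le)
qed

text \<open>The two sides of \<open>phi_Suc\<close> are continuous in the argument and agree on the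
  dense set of naturals.\<close>

lemma phi_add_1:
  assumes x: "x \<in> Zp absv"
  shows "\<phi> (x + 1) =
     (\<Sum>j<n. of_nat (Suc j) * a (Suc j) * (fact j * (x gchoose j) * \<phi> (x - of_nat j)))"
proof -
  obtain X :: "nat \<Rightarrow> nat" where X: "pconv absv (\<lambda>k. of_nat (X k)) x"
    using Zp_nat_limit[OF x] .
  have "pconv absv (\<lambda>k. \<phi> (of_nat (X k) + 1)) (\<phi> (x + 1))"
    by (rule pcont_on_pconv[OF cont]) (use x X in \<open>auto intro!: pconv_add pconv_const\<close>)
  moreover have "pconv absv (\<lambda>k. \<Sum>j<n. of_nat (Suc j) * a (Suc j) *
        (fact j * (of_nat (X k) gchoose j) * \<phi> (of_nat (X k) - of_nat j)))
      (\<Sum>j<n. of_nat (Suc j) * a (Suc j) * (fact j * (x gchoose j) * \<phi> (x - of_nat j)))"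
    using x X
    by (intro pconv_sum pconv_mult pconv_const pconv_gbinomial pcont_on_pconv[OF cont] pconv_diff) auto
  ultimately show ?thesis
    using phi_Suc by (auto simp: add.commute intro: pconv_unique)
qed

text \<open>By \<open>sum_Sstep_funpow\<close> the terms of \<open>phi_add_1\<close> are the
  coefficients of f' times (1-S)^j \<phi>; expanding in powers of S produces the
  \<open>ccoef\<close>.\<close>

lemma phi_add_1_Sstep:
  assumes "x \<in> Zp absv"
  shows "\<phi> (x + 1) = (\<Sum>m<n. (-1) ^ m * ccoef a n m * (Sstep ^^ m) \<phi> x)"
proof -
  have "(\<Sum>m<n. (-1) ^ m * ccoef a n m * (Sstep ^^ m) \<phi> x) =
        (\<Sum>m<n. ccoef a n m * ((-1) ^ m * (Sstep ^^ m) \<phi> x))"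
    by (simp add: mult_ac)
  then show ?thesis
    unfolding sum_ccoef_mult sum_Sstep_funpow phi_add_1[OF assms] by simp
qed

lemma phi_add_1_Sop:
  assumes "x \<in> Zp absv"
  shows "\<phi> (x + 1) = (\<Sum>m<n. (-1) ^ m * ccoef a n m * Sop absv (of_nat m) \<phi> x)"
  unfolding phi_add_1_Sstep[OF assms] using bounded_phi assms by (simp add: Sop_of_nat)

lemma PhiP_functional_equation:
  assumes s: "s \<in> Zp absv"
  shows "pexp absv (a 0) + s * PhiP absv \<phi> (s - 1) =
          (\<Sum>m<n. (-1) ^ m * ccoef a n m * PhiP absv \<phi> (s + of_nat m))"
proof -
  define T where "T \<psi> k = (-1) ^ k * fact k * (s gchoose k) * ((-1) gchoose k) * \<psi> ((-1) - of_nat k)"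
    for \<psi> :: "'a \<Rightarrow> 'a" and k
  have T0: "(\<lambda>k. absv (T ((Sstep ^^ m) \<phi>) k)) \<longlonglongrightarrow> 0" for m
    unfolding T_def using s bounded_phi by (intro Sop_terms_tendsto_0 bounded_on_Zp_Sstep_funpow) auto
  have T0': "(\<lambda>k. absv (((-1) ^ m * ccoef a n m) * T ((Sstep ^^ m) \<phi>) k)) \<longlonglongrightarrow> 0" for m
    using tendsto_mult[OF tendsto_const T0, of "absv ((-1) ^ m * ccoef a n m)"] by (simp add: absv_mult)
  \<comment> \<open>\<open>T\<close> is linear in its function argument and evaluates it only at the
    points \<open>-1 - of_nat k\<close>, all in \<open>Zp absv\<close>.\<close>
  have T: "T (\<lambda>x. \<phi> (x + 1)) k = (\<Sum>m<n. ((-1) ^ m * ccoef a n m) * T ((Sstep ^^ m) \<phi>) k)" for k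
  proof -
    have "T (\<lambda>x. \<phi> (x + 1)) k = (-1) ^ k * fact k * (s gchoose k) * ((-1) gchoose k) *
        (\<Sum>m<n. (-1) ^ m * ccoef a n m * (Sstep ^^ m) \<phi> ((-1) - of_nat k))"
      unfolding T_def by (subst phi_add_1_Sstep) auto
    then show ?thesis
      unfolding T_def sum_distrib_left by (simp only: mult_ac)
  qed
  have "pexp absv (a 0) + s * PhiP absv \<phi> (s - 1) = Sop absv s (\<lambda>x. \<phi> (x + 1)) (-1)"
    using Sop_shift_minus_one[OF bounded_phi s] phi_0 by (simp add: PhiP_def)
  also have "\<dots> = psum absv (\<lambda>k. \<Sum>m<n. ((-1) ^ m * ccoef a n m) * T ((Sstep ^^ m) \<phi>) k)"
    unfolding T[symmetric] by (simp add: Sop_def T_def)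
  also have "\<dots> = (\<Sum>m<n. psum absv (\<lambda>k. ((-1) ^ m * ccoef a n m) * T ((Sstep ^^ m) \<phi>) k))"
    by (intro psum_sum T0')
  also have "\<dots> = (\<Sum>m<n. ((-1) ^ m * ccoef a n m) * psum absv (T ((Sstep ^^ m) \<phi>)))"
    by (intro sum.cong refl psum_cmult T0)
  also have "\<dots> = (\<Sum>m<n. (-1) ^ m * ccoef a n m * PhiP absv \<phi> (s + of_nat m))"
    using s bounded_phi by (simp add: PhiP_def Sop_add_of_nat) (simp add: Sop_def T_def[abs_def])
  finally show ?thesis .
qed

end

end

theorem theorem8p4:
  shows
  "(\<forall>(a::nat \<Rightarrow> complex) n. n \<ge> 1 \<and> a n \<noteq> 0 \<and> (-1) ^ n * Re (a n) < 0 \<longrightarrow>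
      (\<forall>s. set_integrable lborel {..0::real} (PhiC_integrand a n s)) \<and>
      (\<forall>x::real. x \<le> 0 \<longrightarrow>
         (phiC a n has_vector_derivative
            (\<Sum>m<n. (-1) ^ m * ccoef a n m * (1 - complex_of_real x) ^ m * phiC a n x))
           (at x within {..0})) \<and>
      (\<forall>s. exp (a 0) + s * PhiC a n (s - 1) =
            (\<Sum>m<n. (-1) ^ m * ccoef a n m * PhiC a n (s + of_nat m))))
   \<and>
   (\<forall>(p::nat) (absv::'a::field_char_0 \<Rightarrow> real) (a::nat \<Rightarrow> 'a) n (\<phi>::'a \<Rightarrow> 'a).
      is_Cp p absv \<and> n \<ge> 1 \<and> a n \<noteq> 0 \<and>
      (\<forall>k. a k \<in> OCp absv) \<and> a 0 \<in> Ep p absv \<and> a 1 \<in> U1 absv \<and>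
      pcont_on absv (Zp absv) \<phi> \<and>
      Aop \<phi> = fps_const (pexp absv (a 0)) *
               (fps_exp 1 oo (f_fps a n - fps_const (a 0)))
      \<longrightarrow>
      (\<forall>x\<in>Zp absv. \<phi> (x + 1) =
          (\<Sum>m<n. (-1) ^ m * ccoef a n m * Sop absv (of_nat m) \<phi> x)) \<and>
      (\<forall>s\<in>Zp absv. pexp absv (a 0) + s * PhiP absv \<phi> (s - 1) =
          (\<Sum>m<n. (-1) ^ m * ccoef a n m * PhiP absv \<phi> (s + of_nat m))))"
proof (rule conjI; intro allI impI)
  fix a :: "nat \<Rightarrow> complex" and n :: nat
  assume "n \<ge> 1 \<and> a n \<noteq> 0 \<and> (-1) ^ n * Re (a n) < 0"
  then have n: "n \<ge> 1" "(-1) ^ n * Re (a n) < 0"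
    by auto
  show "(\<forall>s. set_integrable lborel {..0::real} (PhiC_integrand a n s)) \<and>
      (\<forall>x::real. x \<le> 0 \<longrightarrow>
         (phiC a n has_vector_derivative
            (\<Sum>m<n. (-1) ^ m * ccoef a n m * (1 - complex_of_real x) ^ m * phiC a n x))
           (at x within {..0})) \<and>
      (\<forall>s. exp (a 0) + s * PhiC a n (s - 1) =
            (\<Sum>m<n. (-1) ^ m * ccoef a n m * PhiC a n (s + of_nat m)))"
    using set_integrable_PhiC_integrand[OF n(1), of a] phiC_has_vector_derivative
      PhiC_functional_equation[OF n(1), of a] n(2) by blast
next
  fix p :: nat and absv :: "'a \<Rightarrow> real" and a :: "nat \<Rightarrow> 'a" and n :: nat and \<phi> :: "'a \<Rightarrow> 'a"
  assume *: "is_Cp p absv \<and> n \<ge> 1 \<and> a n \<noteq> 0 \<and>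
      (\<forall>k. a k \<in> OCp absv) \<and> a 0 \<in> Ep p absv \<and> a 1 \<in> U1 absv \<and>
      pcont_on absv (Zp absv) \<phi> \<and>
      Aop \<phi> = fps_const (pexp absv (a 0)) *
               (fps_exp 1 oo (f_fps a n - fps_const (a 0)))"
  then interpret Cp_field p absv
    by unfold_locales simp
  have hyps: "\<And>k. absv (a k) \<le> 1" "pcont_on absv (Zp absv) \<phi>"
    "Aop \<phi> = fps_const (pexp absv (a 0)) * (fps_exp 1 oo (f_fps a n - fps_const (a 0)))"
    using * by (auto simp: OCp_def)
  show "(\<forall>x\<in>Zp absv. \<phi> (x + 1) =
          (\<Sum>m<n. (-1) ^ m * ccoef a n m * Sop absv (of_nat m) \<phi> x)) \<and>
      (\<forall>s\<in>Zp absv. pexp absv (a 0) + s * PhiP absv \<phi> (s - 1) =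
          (\<Sum>m<n. (-1) ^ m * ccoef a n m * PhiP absv \<phi> (s + of_nat m)))"
    using phi_add_1_Sop[OF hyps] PhiP_functional_equation[OF hyps] by blast
qed

end
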